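(* Let $\Pi$ be a valid collocation projection (relative to the polynomial degree $p$) with associated quadrature strength $\tau$ and primary aliasing coefficient $d_\Pi$, and let $\alpha,\beta\in\mathbb{R}$ with $\alpha+\beta=1$. If $i,j,k$ are integers with $0\le i,j,k\le p$ and $i+j+k=\tau+2$, then $$\Delta_{ijk}(\alpha,\beta)=\frac{d_\Pi}{2}\,\frac{\binom{2i}{i}\binom{2j}{j}\binom{2k}{k}}{\binom{2\tau+2}{\tau+1}}\,\bigl(\beta(i+j)-\alpha(\tau+2-(i+j))\bigr).$$
   Context: Let $\Omega=[-1,1]$, let $\Gamma=\partial\Omega=\{-1,1\}$ with outward normal $\hat n$ (so $\hat n(\pm1)=\pm1$ and $\int_\Gamma g\,\hat n\,d\Gamma=g(1)-g(-1)$), let $\mathcal{P}^m$ be the space of polynomials of degree at most $m$, and let $L_i$ be the $i$th Legendre polynomial with $L_i(1)=1$. A collocation projection $\Pi$ with values in $\mathcal{P}^q$ is the interpolation operator at $q+1$ distinct nodes in $\Omega$: $\Pi(f)$ is the unique element of $\mathcal{P}^q$ agreeing with $f$ at the nodes. Given the polynomial degree $p$, $\Pi$ is called valid if (1) its nodes are symmetrically distributed in $\Omega$ (about $0$), and (2) the nodes induce a quadrature rule of strength $\tau\ge 2p-1$ on $\Omega$, i.e. $\int_\Omega f\,d\Omega=\int_\Omega\Pi(f)\,d\Omega$ for all $f\in\mathcal{P}^\tau$. The primary aliasing coefficient of $\Pi$ is $d_\Pi:=\int_\Omega\Pi(L_{\tau+1})\,d\Omega$. For $0\le i,j,k\le p$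 the aliasing error tensor is $$\Delta_{ijk}(\alpha,\beta):=\int_\Omega \frac{dL_k}{dx}L_iL_j\,d\Omega-\beta\int_\Gamma L_iL_jL_k\,\hat n\,d\Gamma+\int_\Omega\Bigl(\beta\frac{dL_i}{dx}\Pi(L_jL_k)+\beta\frac{dL_j}{dx}\Pi(L_iL_k)-\alpha\frac{dL_k}{dx}\Pi(L_iL_j)\Bigr)d\Omega .$$
   Formalization: The quadrature is also assumed exact on polynomials of degree p+q-1 (automatic if q ≤ p or p+q-1 ≤ τ); without this the formula fails, e.g. p=2, q=3, nodes ±1, ±1/3, (i,j,k)=(1,2,2), α=1, β=0 gives 0 instead of -8/15. *)

theory Defs
  imports "HOL-Analysis.Analysis" "HOL-Computational_Algebra.Polynomial"
begin

section \<open>Legendre polynomials\<close>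

text \<open>
  The definition is Rodrigues' formula. The lemmas \<open>degree_legendre\<close>, \<open>legendre_orthogonal\<close> and
  \<open>poly_legendre_1\<close> below are the defining properties of the Legendre polynomials in the
  normalization $L_n(1) = 1$.
\<close>

definition legendre :: "nat \<Rightarrow> real poly" where
  "legendre n = smult (1 / (2 ^ n * fact n)) ((pderiv ^^ n) ([:-1, 0, 1:] ^ n))"

definition integral_Omega :: "real poly \<Rightarrow> real" where
  "integral_Omega P = integral {-1..1} (poly P)"

text \<open>The outward normal on the boundary \<open>{-1, 1}\<close> is \<open>-1\<close> at \<open>-1\<close> and \<open>1\<close> at \<open>1\<close>.\<close>

definition integral_Gamma_normal :: "real poly \<Rightarrow> real" where
  "integral_Gamma_normal P = poly P 1 - poly P (-1)"

lemma degree_legendre: "degree (legendre n) = n"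
proof -
  have "degree ([:-1, 0, 1:] ^ n :: real poly) = 2 * n"
    by (simp add: degree_power_eq)
  then show ?thesis
    by (simp add: legendre_def degree_higher_pderiv)
qed

lemma poly_legendre_1: "poly (legendre n) 1 = 1"
proof -
  have ex: "\<exists>S. (pderiv ^^ m) ([:-1, 1:] ^ n * R) = [:-1, 1:] ^ (n - m) * S
            \<and> fact (n - m) * poly S 1 = fact n * poly R 1"
    if "m \<le> n" for m and R :: "real poly"
    using that
  proof (induction m)
    case (Suc m)
    then obtain S where S: "(pderiv ^^ m) ([:-1, 1:] ^ n * R) = [:-1, 1:] ^ (n - m) * S"
      "fact (n - m) * poly S 1 = fact n * poly R 1" by auto
    define k where "k = n - Suc m"
    have k: "n - m = Suc k" using Suc.prems by (simp add: k_def)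
    have "(pderiv ^^ Suc m) ([:-1, 1:] ^ n * R) = pderiv ([:-1, 1:] ^ Suc k * S)"
      using S(1) k by simp
    also have "\<dots> = [:-1, 1:] ^ k * ([:-1, 1:] * pderiv S + smult (of_nat (Suc k)) S)"
      by (simp only: pderiv_mult pderiv_power_Suc)
         (simp add: pderiv_pCons algebra_simps)
    finally show ?case using S(2)
      by (intro exI[of _ "[:-1, 1:] * pderiv S + smult (of_nat (Suc k)) S"])
         (simp add: k k_def[symmetric] algebra_simps)
  qed auto
  have "[:-1, 0, 1:] ^ n = ([:-1, 1:] ^ n * [:1, 1:] ^ n :: real poly)"
    by (simp flip: power_mult_distrib)
  then show ?thesis
    using ex[of n "[:1, 1:] ^ n"] by (auto simp: legendre_def poly_power)
qed

lemma has_integral_poly_pderiv: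
  "(poly (pderiv P) has_integral integral_Gamma_normal P) {-1..1}" for P :: "real poly"
  unfolding integral_Gamma_normal_def
  by (rule fundamental_theorem_of_calculus)
     (auto simp flip: has_real_derivative_iff_has_vector_derivative
           intro: has_field_derivative_at_within poly_DERIV)

lemma integral_Omega_pderiv: "integral_Omega (pderiv P) = integral_Gamma_normal P"
  unfolding integral_Omega_def using has_integral_poly_pderiv by (rule integral_unique)

lemma integral_Omega_add: "integral_Omega (P + Q) = integral_Omega P + integral_Omega Q"
  unfolding integral_Omega_def poly_add
  by (intro Henstock_Kurzweil_Integration.integral_add integrable_continuous_interval
      continuous_intros)

lemma legendre_orthogonal:
  assumes "degree Q < n"
  shows "integral_Omega (legendre n * Q) = 0"
proof -
  define w :: "real poly" where "w = [:-1, 0, 1:] ^ n"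
  have dv: "[:-1, 0, 1:] ^ (n - m) dvd (pderiv ^^ m) w" if "m \<le> n" for m
    using that
  proof (induction m)
    case (Suc m)
    then obtain S where S: "(pderiv ^^ m) w = [:-1, 0, 1:] ^ (n - m) * S" by (auto elim!: dvdE)
    define k where "k = n - Suc m"
    have k: "n - m = Suc k" using Suc.prems by (simp add: k_def)
    have "(pderiv ^^ Suc m) w = pderiv ([:-1, 0, 1:] ^ Suc k * S)" using S k by simp
    also have "[:-1, 0, 1:] ^ k dvd \<dots>"
      unfolding pderiv_mult pderiv_power_Suc
      by (rule dvd_add[OF dvd_mult2[OF le_imp_power_dvd] dvd_mult[OF dvd_mult2[OF dvd_smult]]]) auto
    finally show ?case by (simp add: k_def)
  qed (simp add: w_def)
  have step: "integral_Omega ((pderiv ^^ m) w * R) = (- 1) ^ m * integral_Omega (w * (pderiv ^^ m) R)"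
    if "m \<le> n" for m R
    using that
  proof (induction m arbitrary: R)
    case (Suc m)
    have "[:-1, 0, 1:] dvd [:-1, 0, 1:] ^ (n - m)" using Suc.prems by (intro dvd_power) auto
    then have "[:-1, 0, 1:] dvd (pderiv ^^ m) w" using dv[of m] Suc.prems by (auto intro: dvd_trans)
    then have "integral_Gamma_normal ((pderiv ^^ m) w * R) = 0"
      by (auto simp: integral_Gamma_normal_def elim!: dvdE)
    then have "integral_Omega ((pderiv ^^ Suc m) w * R) = - integral_Omega ((pderiv ^^ m) w * pderiv R)"
      using integral_Omega_pderiv[of "(pderiv ^^ m) w * R"]
      by (simp add: pderiv_mult integral_Omega_add mult.commute)
    then show ?case using Suc by (simp add: funpow_swap1)
  qed simp
  have "(pderiv ^^ n) Q = 0"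
    using assms by (intro poly_eqI) (simp add: coeff_higher_pderiv coeff_eq_0)
  then have "integral_Omega ((pderiv ^^ n) w * Q) = 0"
    using step[of n Q] integral_Omega_pderiv[of 0] by (simp add: integral_Gamma_normal_def)
  moreover have "integral_Omega (legendre n * Q)
      = 1 / (2 ^ n * fact n) * integral_Omega ((pderiv ^^ n) w * Q)"
    unfolding integral_Omega_def legendre_def w_def mult_smult_left poly_smult
    by (rule integral_mult_right)
  ultimately show ?thesis by simp
qed


section \<open>Collocation projections\<close>

text \<open>A collocation projection onto polynomials of degree at most \<open>q\<close> is given by its set \<open>X\<close>
  of \<open>q + 1\<close> nodes.\<close>

definition collocation_nodes :: "nat \<Rightarrow> real set \<Rightarrow> bool" where
  "collocation_nodes q X \<longleftrightarrow> finite X \<and> card X = q + 1 \<and> X \<subseteq> {-1..1}"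

definition collocation :: "nat \<Rightarrow> real set \<Rightarrow> (real \<Rightarrow> real) \<Rightarrow> real poly" where
  "collocation q X f = (THE P. degree P \<le> q \<and> (\<forall>x\<in>X. poly P x = f x))"

lemma collocation_ex1:
  assumes "collocation_nodes q X"
  shows "\<exists>!P. degree P \<le> q \<and> (\<forall>x\<in>X. poly P x = f x)"
proof (rule ex_ex1I)
  have X: "finite X" "card X = q + 1" using assms by (auto simp: collocation_nodes_def)
  define b where "b x = (\<Prod>y\<in>X - {x}. smult (1 / (x - y)) [:-y, 1:])" for x
  have b: "poly (b x) z = (if z = x then 1 else 0)" if "x \<in> X" "z \<in> X" for x z
    using X(1) that by (auto simp: b_def poly_prod divide_simps intro!: prod.neutral)
  have "degree (b x) \<le> q" if "x \<in> X" for x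
  proof -
    have "degree (b x) \<le> sum (degree \<circ> (\<lambda>y. smult (1 / (x - y)) [:-y, 1:])) (X - {x})"
      unfolding b_def by (intro degree_prod_sum_le) (simp add: X)
    also have "\<dots> \<le> (\<Sum>y\<in>X - {x}. 1)"
      by (intro sum_mono) simp
    also have "\<dots> = q" using X that by simp
    finally show ?thesis .
  qed
  then have "degree (\<Sum>x\<in>X. smult (f x) (b x)) \<le> q"
    by (intro degree_sum_le X(1)) (meson degree_smult_le le_trans)
  moreover have "poly (\<Sum>x\<in>X. smult (f x) (b x)) z = f z" if "z \<in> X" for z
    using X(1) that by (simp add: poly_sum b if_distrib sum.delta cong: if_cong)
  ultimately show "\<exists>P. degree P \<le> q \<and> (\<forall>x\<in>X. poly P x = f x)" by blast
next
  fix P Q assume "degree P \<le> q \<and> (\<forall>x\<in>X. poly P x = f x)" "degree Q \<le> q \<and> (\<forall>x\<in>X. poly Q x = f x)"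
  then show "P = Q" using assms
    by (intro poly_eqI_degree[of X]) (auto simp: collocation_nodes_def)
qed

definition quadrature_exact :: "nat \<Rightarrow> real set \<Rightarrow> nat \<Rightarrow> bool" where
  "quadrature_exact q X m \<longleftrightarrow>
     (\<forall>P. degree P \<le> m \<longrightarrow> integral_Omega P = integral_Omega (collocation q X (poly P)))"

text \<open>The bound \<open>2 * p \<le> \<tau> + 1\<close> is $\tau \ge 2p - 1$ without truncated subtraction. The strength
  \<open>\<tau>\<close> is not required to be the largest degree of exactness.\<close>

definition valid_collocation :: "nat \<Rightarrow> nat \<Rightarrow> real set \<Rightarrow> nat \<Rightarrow> bool" where
  "valid_collocation p q X \<tau> \<longleftrightarrow>
     collocation_nodes q X \<and> (\<forall>x\<in>X. - x \<in> X) \<and> 2 * p \<le> \<tau> + 1 \<and> quadrature_exact q X \<tau>"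

definition primary_aliasing_coeff :: "nat \<Rightarrow> real set \<Rightarrow> nat \<Rightarrow> real" where
  "primary_aliasing_coeff q X \<tau> = integral_Omega (collocation q X (poly (legendre (\<tau> + 1))))"

definition aliasing_error ::
    "nat \<Rightarrow> real set \<Rightarrow> real \<Rightarrow> real \<Rightarrow> nat \<Rightarrow> nat \<Rightarrow> nat \<Rightarrow> real" where
  "aliasing_error q X \<alpha> \<beta> i j k =
     (let L = legendre; proj = (\<lambda>P. collocation q X (poly P)) in
      integral_Omega (pderiv (L k) * L i * L j)
      - \<beta> * integral_Gamma_normal (L i * L j * L k)
      + integral_Omega
          (smult \<beta> (pderiv (L i) * proj (L j * L k))
           + smult \<beta> (pderiv (L j) * proj (L i * L k))
           - smult \<alpha> (pderiv (L k) * proj (L i * L j))))"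

text \<open>
  The products \<open>pderiv (L i) * proj (L j * L k)\<close> occurring in \<open>aliasing_error\<close> have degree at most
  \<open>p + q - 1\<close>, so exactness of the quadrature in that degree says that the discrete and the exact
  integral of these products agree. This holds automatically if \<open>q \<le> p\<close>, and also whenever
  \<open>p + q - 1 \<le> \<tau>\<close>, for instance for Gauss and Gauss-Lobatto nodes with \<open>q \<ge> p\<close>.
\<close>

lemma valid_collocation_exact_products:
  assumes "valid_collocation p q X \<tau>" "p + q - 1 \<le> \<tau>"
  shows "quadrature_exact q X (p + q - 1)"
  using assms by (auto simp: valid_collocation_def quadrature_exact_def)

lemma valid_collocation_exact_products':
  assumes "valid_collocation p q X \<tau>" "q \<le> p"
  shows "quadrature_exact q X (p + q - 1)"
  using assms
  by (intro valid_collocation_exact_products[OF assms(1)]) (auto simp: valid_collocation_def)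

end

(* On the nodes a collocation projection is the identity, so exactness in degree p + q - 1 removes the
   inner projections: each integral of L_i' * Pi(L_j * L_k) is the quadrature of L_i' * L_j * L_k.
   Integrating the boundary term by parts and using alpha + beta = 1, the aliasing error becomes
   beta * E(L_i' L_j L_k + L_i L_j' L_k) - alpha * E(L_i L_j L_k') with the quadrature error E.
   All arguments have degree tau + 1, one above the strength, where E only sees the coefficient of
   x^(tau + 1): E f = coeff f (tau + 1) / lead_coeff L_(tau + 1) * d. The leading coefficient
   binomial(2n, n) / 2^n of L_n then gives the formula. *)

theory Submission
  imports Defs
begin

text \<open>Only the top term \<open>x^(2n)\<close> of \<open>(x^2 - 1)^n\<close> reaches
  \<open>x^n\<close> after n derivatives, with factor (n+1)...(2n) = (2n)!/n!, which is the
  Pochhammer symbol below. Rodrigues' normalization 1/(2^n n!) turns this into the binomial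
  coefficient.\<close>

lemma coeff_legendre: "coeff (legendre n) n = real ((2 * n) choose n) / 2 ^ n"
proof -
  have deg: "degree ([:-1, 0, 1:] ^ n :: real poly) = n + n"
    by (simp add: degree_power_eq)
  then have lead: "coeff ([:-1, 0, 1:] ^ n :: real poly) (n + n) = 1"
    using lead_coeff_power[of "[:-1, 0, 1:] :: real poly" n] by simp
  have "fact (2 * n) = (fact n * pochhammer (real (Suc n)) n :: real)"
    using pochhammer_product[of n "2 * n" "1 :: real"] by (simp add: pochhammer_fact add.commute)
  then have "pochhammer (real (Suc n)) n = real ((2 * n) choose n) * fact n"
    by (simp add: binomial_fact field_simps)
  then show ?thesis
    by (simp add: legendre_def coeff_higher_pderiv lead)
qed

lemma integral_Omega_smult: "integral_Omega (smult c P) = c * integral_Omega P"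
  by (simp add: integral_Omega_def poly_smult[abs_def])

lemma integral_Omega_diff: "integral_Omega (P - Q) = integral_Omega P - integral_Omega Q"
  using integral_Omega_add[of "P - Q" Q] by simp

lemma integral_Omega_legendre:
  assumes "0 < n"
  shows "integral_Omega (legendre n) = 0"
  using legendre_orthogonal[of 1 n] assms by simp

lemma
  assumes "collocation_nodes q X"
  shows degree_collocation: "degree (collocation q X f) \<le> q"
    and poly_collocation: "x \<in> X \<Longrightarrow> poly (collocation q X f) x = f x"
  using theI'[OF collocation_ex1[OF assms, of f]] by (auto simp: collocation_def)

lemma collocation_eqI:
  assumes "collocation_nodes q X" "degree P \<le> q" "\<And>x. x \<in> X \<Longrightarrow> poly P x = f x"
  shows "collocation q X f = P"
  unfolding collocation_def
  by (rule the1_equality[OF collocation_ex1[OF assms(1)]]) (use assms in auto)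

lemma collocation_cong:
  assumes "\<And>x. x \<in> X \<Longrightarrow> f x = g x"
  shows "collocation q X f = collocation q X g"
  using assms by (simp add: collocation_def cong: conj_cong)

lemma collocation_add:
  assumes "collocation_nodes q X"
  shows "collocation q X (\<lambda>x. f x + g x) = collocation q X f + collocation q X g"
  by (rule collocation_eqI[OF assms])
     (auto intro: degree_add_le simp: degree_collocation poly_collocation assms)

lemma collocation_scale:
  assumes "collocation_nodes q X"
  shows "collocation q X (\<lambda>x. c * f x) = smult c (collocation q X f)"
  by (rule collocation_eqI[OF assms])
     (auto intro: degree_smult_le[THEN order_trans] simp: degree_collocation poly_collocation assms)

text \<open>The sign is quadrature minus exact integral, so that
  \<open>legendre (\<tau> + 1)\<close> has error exactly
  \<open>primary_aliasing_coeff q X \<tau>\<close>.\<close>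

definition quadrature_error :: "nat \<Rightarrow> real set \<Rightarrow> real poly \<Rightarrow> real" where
  "quadrature_error q X P = integral_Omega (collocation q X (poly P)) - integral_Omega P"

lemma quadrature_error_add:
  assumes "collocation_nodes q X"
  shows "quadrature_error q X (P + Q) = quadrature_error q X P + quadrature_error q X Q"
  using collocation_add[OF assms, of "poly P" "poly Q"]
  by (simp add: quadrature_error_def integral_Omega_add poly_add[abs_def])

lemma quadrature_error_smult:
  assumes "collocation_nodes q X"
  shows "quadrature_error q X (smult c P) = c * quadrature_error q X P"
  using collocation_scale[OF assms, of c "poly P"]
  by (simp add: quadrature_error_def integral_Omega_smult poly_smult[abs_def] algebra_simps)

lemma quadrature_error_eq_0:
  assumes "quadrature_exact q X m" "degree P \<le> m"
  shows "quadrature_error q X P = 0"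
  using assms by (simp add: quadrature_error_def quadrature_exact_def)

text \<open>Subtracting the multiple of \<open>legendre (\<tau> + 1)\<close> with the same top
  coefficient leaves degree at most \<open>\<tau>\<close>, where the error vanishes.\<close>

lemma quadrature_error_Suc_degree:
  assumes X: "collocation_nodes q X" and exact: "quadrature_exact q X \<tau>"
    and deg: "degree P \<le> \<tau> + 1"
  shows "quadrature_error q X P =
    coeff P (\<tau> + 1) / coeff (legendre (\<tau> + 1)) (\<tau> + 1) * primary_aliasing_coeff q X \<tau>"
proof -
  define L where "L = legendre (\<tau> + 1)"
  define c where "c = coeff P (\<tau> + 1) / coeff L (\<tau> + 1)"
  have degL: "degree L = \<tau> + 1" by (simp add: L_def degree_legendre)
  then have "coeff L (\<tau> + 1) \<noteq> 0"
    by (metis add_is_0 degree_0 leading_coeff_0_iff one_neq_zero)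
  then have top: "coeff (P - smult c L) (\<tau> + 1) = 0"
    by (simp add: c_def)
  have "degree (P - smult c L) \<le> \<tau>"
  proof (rule degree_le, intro allI impI)
    fix n assume "\<tau> < n"
    then show "coeff (P - smult c L) n = 0"
      using top deg degL by (cases "n = \<tau> + 1") (auto simp: coeff_eq_0)
  qed
  then have "quadrature_error q X (P - smult c L) = 0"
    by (rule quadrature_error_eq_0[OF exact])
  then have "quadrature_error q X P = c * quadrature_error q X L"
    using quadrature_error_add[OF X, of "P - smult c L" "smult c L"]
    by (simp add: quadrature_error_smult[OF X])
  \<comment> \<open>The exact integral of \<open>L\<close> is 0, since \<open>\<tau> + 1 > 0\<close>
    makes \<open>L\<close> orthogonal to constants; only its quadrature remains.\<close>
  also have "quadrature_error q X L = primary_aliasing_coeff q X \<tau>"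
    by (simp add: quadrature_error_def primary_aliasing_coeff_def L_def integral_Omega_legendre)
  finally show ?thesis by (simp add: c_def L_def)
qed

text \<open>The product on the left has low enough degree to be integrated exactly by the
  quadrature, which sees only node values; there \<open>collocation q X (poly Q)\<close> agrees with
  \<open>Q\<close>.\<close>

lemma integral_Omega_pderiv_mult_collocation:
  assumes X: "collocation_nodes q X" and exact: "quadrature_exact q X (p + q - 1)"
    and "degree P \<le> p"
  shows "integral_Omega (pderiv P * collocation q X (poly Q))
    = quadrature_error q X (pderiv P * Q) + integral_Omega (pderiv P * Q)"
proof -
  let ?C = "collocation q X (poly Q)"
  have "degree (pderiv P * ?C) \<le> p + q - 1"
  \<comment> \<open>For constant \<open>P\<close> the degree estimate gives only \<open>q\<close>,
    which exceeds the truncated \<open>p + q - 1\<close> if \<open>p = 0 < q\<close>; but then the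
    product is 0.\<close>
  proof (cases "degree P = 0")
    case True
    then show ?thesis by (simp add: pderiv_eq_0_iff[THEN iffD2])
  next
    case False
    then show ?thesis
      using degree_mult_le[of "pderiv P" ?C] degree_collocation[OF X, of "poly Q"] assms(3)
      by (simp add: degree_pderiv)
  qed
  then have "integral_Omega (pderiv P * ?C) = integral_Omega (collocation q X (poly (pderiv P * ?C)))"
    using exact by (simp add: quadrature_exact_def)
  also have "collocation q X (poly (pderiv P * ?C)) = collocation q X (poly (pderiv P * Q))"
    by (rule collocation_cong) (simp add: poly_collocation[OF X])
  finally show ?thesis by (simp add: quadrature_error_def)
qed

text \<open>If a factor falls short of its degree bound, both sides vanish. Upper bounds therefore
  suffice, and exact degrees of products need not be computed.\<close>

lemma coeff_mult_top:
  fixes P Q :: "'a :: comm_semiring_0 poly"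
  assumes "degree P \<le> m" "degree Q \<le> n"
  shows "coeff (P * Q) (m + n) = coeff P m * coeff Q n"
proof (cases "degree P = m \<and> degree Q = n")
  case True
  then show ?thesis by (auto simp: coeff_mult_degree_sum)
next
  case False
  then have "degree P + degree Q < m + n" using assms by linarith
  then have "coeff (P * Q) (m + n) = 0"
    by (intro coeff_eq_0) (use degree_mult_le[of P Q] in linarith)
  moreover have "coeff P m = 0 \<or> coeff Q n = 0"
    using False assms by (metis coeff_eq_0 le_neq_implies_less)
  ultimately show ?thesis by auto
qed

lemma degree_pderiv_legendre_mult:
  assumes "i + j + k = m + 1"
  shows "degree (pderiv (legendre i) * (legendre j * legendre k)) \<le> m"
\<comment> \<open>Differentiation lowers the degree only if \<open>i > 0\<close>; for
  \<open>i = 0\<close> the general estimate would give \<open>m + 1\<close>, but the product is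
  0.\<close>
proof (cases "i = 0")
  case True
  then show ?thesis
    by (simp add: pderiv_eq_0_iff[THEN iffD2] degree_legendre)
next
  case False
  then show ?thesis
    using degree_mult_le[of "pderiv (legendre i)" "legendre j * legendre k"]
      degree_mult_le[of "legendre j" "legendre k"] assms
    by (simp add: degree_legendre degree_pderiv)
qed

text \<open>Top terms multiply, and differentiating the top term of \<open>legendre i\<close> brings
  down the factor \<open>i\<close>. Hence the three placements of the derivative differ only in this
  factor.\<close>

lemma coeff_pderiv_legendre_mult:
  assumes "i + j + k = m + 1"
  shows "coeff (pderiv (legendre i) * (legendre j * legendre k)) m
    = real i * (coeff (legendre i) i * coeff (legendre j) j * coeff (legendre k) k)"
proof (cases i)
  case 0
  then show ?thesis
    by (simp add: pderiv_eq_0_iff[THEN iffD2] degree_legendre)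
next
  case (Suc l)
  have jk: "coeff (legendre j * legendre k) (j + k) = coeff (legendre j) j * coeff (legendre k) k"
    by (rule coeff_mult_top) (simp_all add: degree_legendre)
  have "coeff (pderiv (legendre i) * (legendre j * legendre k)) (l + (j + k))
      = coeff (pderiv (legendre i)) l * coeff (legendre j * legendre k) (j + k)"
    using degree_mult_le[of "legendre j" "legendre k"]
    by (intro coeff_mult_top) (simp_all add: degree_legendre degree_pderiv Suc)
  then show ?thesis
    using assms by (simp add: jk coeff_pderiv Suc add.assoc)
qed

theorem theorem1:
  fixes p q \<tau> i j k :: nat and X :: "real set" and \<alpha> \<beta> :: real
  assumes "valid_collocation p q X \<tau>"
    and "quadrature_exact q X (p + q - 1)"
    and "\<alpha> + \<beta> = 1"
    and "i \<le> p" and "j \<le> p" and "k \<le> p"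
    and "i + j + k = \<tau> + 2"
  shows "aliasing_error q X \<alpha> \<beta> i j k =
    primary_aliasing_coeff q X \<tau> / 2
    * (real ((2 * i) choose i) * real ((2 * j) choose j) * real ((2 * k) choose k)
       / real ((2 * \<tau> + 2) choose (\<tau> + 1)))
    * (\<beta> * (real i + real j) - \<alpha> * (real \<tau> + 2 - (real i + real j)))"
proof -
  have X: "collocation_nodes q X" and exact: "quadrature_exact q X \<tau>"
    using assms(1) by (auto simp: valid_collocation_def)
  define A where "A a b c = pderiv (legendre a) * (legendre b * legendre c)" for a b c
  define l where "l n = coeff (legendre n) n" for n
  define E where "E = quadrature_error q X"
  \<comment> \<open>The part of the error common to all three products: each error is
    \<open>D\<close> times the index of the differentiated factor.\<close>
  define D where "D = primary_aliasing_coeff q X \<tau> / l (\<tau> + 1) * (l i * l j * l k)"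
  have EA: "E (A a b c) = primary_aliasing_coeff q X \<tau> / l (\<tau> + 1) * (real a * (l a * l b * l c))"
    if "a + b + c = \<tau> + 2" for a b c
    using quadrature_error_Suc_degree[OF X exact, of "A a b c"] that
      degree_pderiv_legendre_mult[of a b c "\<tau> + 1"] coeff_pderiv_legendre_mult[of a b c "\<tau> + 1"]
    by (simp add: A_def E_def l_def)
  have E: "E (A i j k) = real i * D" "E (A j i k) = real j * D" "E (A k i j) = real k * D"
    using assms(7) by (simp_all add: EA D_def)
  have proj: "integral_Omega (pderiv (legendre a) * collocation q X (poly (legendre b * legendre c)))
      = E (A a b c) + integral_Omega (A a b c)" if "a \<le> p" for a b c
    using that unfolding E_def A_def
    by (intro integral_Omega_pderiv_mult_collocation[OF X assms(2)]) (simp add: degree_legendre)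
  have "pderiv (legendre i * legendre j * legendre k) = A i j k + A j i k + A k i j"
    by (simp add: A_def pderiv_mult algebra_simps)
  then have boundary: "integral_Gamma_normal (legendre i * legendre j * legendre k)
      = integral_Omega (A i j k) + integral_Omega (A j i k) + integral_Omega (A k i j)"
    by (simp flip: integral_Omega_pderiv add: integral_Omega_add)
  have volume: "pderiv (legendre k) * legendre i * legendre j = A k i j"
    by (simp add: A_def algebra_simps)
  have \<alpha>: "\<alpha> = 1 - \<beta>" using assms(3) by simp
  \<comment> \<open>All exact integrals cancel: those of \<open>A i j k\<close> and
    \<open>A j i k\<close> against the boundary term, and that of \<open>A k i j\<close> because its
    total coefficient is 1 - \<beta> - \<alpha> = 0.\<close>
  have "aliasing_error q X \<alpha> \<beta> i j k = \<beta> * (E (A i j k) + E (A j i k)) - \<alpha> * E (A k i j)"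
    using assms(4-6)
    unfolding aliasing_error_def Let_def boundary volume integral_Omega_add integral_Omega_diff
      integral_Omega_smult
    by (simp add: proj \<alpha> right_diff_distrib left_diff_distrib distrib_left)
  also have "\<dots> = D * (\<beta> * (real i + real j) - \<alpha> * real k)"
    by (simp add: E algebra_simps)
  also have "real k = real \<tau> + 2 - (real i + real j)"
    using assms(7) by linarith
  also have "D = primary_aliasing_coeff q X \<tau> / 2
    * (real ((2 * i) choose i) * real ((2 * j) choose j) * real ((2 * k) choose k)
       / real ((2 * \<tau> + 2) choose (\<tau> + 1)))"
  proof -
    \<comment> \<open>The indices sum to one more than \<open>\<tau> + 1\<close>, so one power of 2
      survives the division by \<open>l (\<tau> + 1)\<close>: this is the 1/2 in the
      formula.\<close>
    have "(2 :: real) ^ i * 2 ^ j * 2 ^ k = 2 * 2 ^ (\<tau> + 1)"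
      using assms(7) by (simp flip: power_add)
    then have "l i * l j * l k = real ((2 * i) choose i) * real ((2 * j) choose j)
        * real ((2 * k) choose k) / (2 * 2 ^ (\<tau> + 1))"
      unfolding l_def coeff_legendre times_divide_times_eq by (simp only:)
    moreover have "l (\<tau> + 1) = real ((2 * \<tau> + 2) choose (\<tau> + 1)) / 2 ^ (\<tau> + 1)"
      using coeff_legendre[of "\<tau> + 1"] by (simp add: l_def)
    ultimately show ?thesis
      unfolding D_def by (simp del: binomial_Suc_Suc)
  qed
  finally show ?thesis .
qed

end
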